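(* Let $L_{\mathrm{Rect}}$ and $L_{\mathrm{Evil}}$ be the languages defined in the context. Define $b:L_{\mathrm{Rect}}\to L_{\mathrm{Evil}}$ on a word $w$ by (1) substituting $2\mapsto p$, $u\mapsto q$, $d\mapsto r$, $1\mapsto s$, and then (2) if the resulting word contains an $r$, reversing the prefix lying to the left of its rightmost $r$. Then $b$ is a well-defined, length-preserving bijection $L_{\mathrm{Rect}}\to L_{\mathrm{Evil}}$, whose inverse is given by (1) reversing the prefix to the left of the rightmost $r$ (if any), and then (2) substituting $p\mapsto 2$, $q\mapsto u$, $r\mapsto d$, $s\mapsto 1$.
   Context: Permutations are written in one-line form; $e_0$ is the empty permutation. For $\pi\in S_n$ and $1\le i,j\le n+1$, $\rho_{i,j}(\pi)\in S_{n+1}$ is obtained by increasing by $1$ every entry $\ge i$ and inserting value $i$ at position $j$; for $a>b$, $\gamma_{a,b}(\pi)$ moves the entry at position $a$ to position $b$. A word $x_m\cdots x_1$ stands for the composition of the corresponding operators with the rightmost applied first, and a language consists of the nonempty words for which the composition applied to $e_0$ is defined (each operator applied within its domain). Rectangular permutations avoid $2413,2431,4213,4231$. On them: $\psi_1=\rho_{1,1}$ (domain: all rectangular, including $e_0$); $\psi_2=\rho_{1,2}$ and $\psi_u(\pi)=\rho_{\pi_1,1}(\pi)$ (domain: rectangular of size $\ge1$ with $\pi_1\neq1$); $\psi_d(\pi)=\rho_{\pi_1+1,1}(\pi)$ (domain: rectangular of size $\ge1$). $L_{\mathrm{Rect}}$ is the resulting language over $\{1,2,u,d\}$. Evil-avoiding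 permutations avoid $2413,4132,4213,3214$. A recoil of $\pi\in S_n$ is $i$ with $\pi^{-1}_i>\pi^{-1}_{i+1}$. $\pi\in S_n$ is $(a,b)$-sandwiched ($a\ge0,b\ge1$) if $(\pi_1,\dots,\pi_a)=(1,\dots,a)$ and $(\pi_{n-b+1},\dots,\pi_n)=(a+1,\dots,a+b)$. On evil-avoiding permutations: $\psi_p=\rho_{1,1}$ (domain: non-identity); $\psi_q$ (domain: non-identity) with $\psi_q(\pi)=\gamma_{n-b+2,a+2}(\rho_{t+1,1}(\pi))$ if $\pi$ is $(a,b)$-sandwiched and $\rho_{t+1,1}(\pi)$ otherwise, where $t$ is the smallest recoil of $\pi$; $\psi_r(\pi)=\rho_{1,n+1}(\pi)$ (domain: size $\ge1$); $\psi_s(\pi)=\rho_{\pi_n+1,n+1}(\pi)$, $\psi_s(e_0)=[1]$ (domain: identity permutations $e_n$, $n\ge0$, and those $\pi\in S_n$ with $(\pi_{n-t+1},\dots,\pi_n)=(1,\dots,t)$ for some $t\ge1$). $L_{\mathrm{Evil}}$ is the resulting language over $\{p,q,r,s\}$. *)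

theory Defs
  imports Main
begin

text \<open>A permutation of size n is a list of the values 1..n (one-line form);
  the empty list is e_0.  Positions are 1-based in the paper; list indices are 0-based.\<close>

definition order_iso :: "nat list \<Rightarrow> nat list \<Rightarrow> bool" where
  "order_iso s \<sigma> \<longleftrightarrow> length s = length \<sigma> \<and>
     (\<forall>a < length s. \<forall>b < length s. s ! a < s ! b \<longleftrightarrow> \<sigma> ! a < \<sigma> ! b)"

definition contains :: "nat list \<Rightarrow> nat list \<Rightarrow> bool" where
  "contains \<pi> \<sigma> \<longleftrightarrow> (\<exists>s \<in> set (subseqs \<pi>). order_iso s \<sigma>)"

definition avoids :: "nat list \<Rightarrow> nat list \<Rightarrow> bool" where
  "avoids \<pi> \<sigma> \<longleftrightarrow> \<not> contains \<pi> \<sigma>"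

definition rectangular :: "nat list \<Rightarrow> bool" where
  "rectangular \<pi> \<longleftrightarrow> avoids \<pi> [2,4,1,3] \<and> avoids \<pi> [2,4,3,1] \<and>
     avoids \<pi> [4,2,1,3] \<and> avoids \<pi> [4,2,3,1]"

definition evil_avoiding :: "nat list \<Rightarrow> bool" where
  "evil_avoiding \<pi> \<longleftrightarrow> avoids \<pi> [2,4,1,3] \<and> avoids \<pi> [4,1,3,2] \<and>
     avoids \<pi> [4,2,1,3] \<and> avoids \<pi> [3,2,1,4]"

definition rho :: "nat \<Rightarrow> nat \<Rightarrow> nat list \<Rightarrow> nat list" where
  "rho i j \<pi> = (let \<pi>' = map (\<lambda>x. if x \<ge> i then x + 1 else x) \<pi>
                in take (j - 1) \<pi>' @ [i] @ drop (j - 1) \<pi>')"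

text \<open>gamma a b (a > b): move the entry at (1-based) position a to position b.\<close>
definition gamma :: "nat \<Rightarrow> nat \<Rightarrow> nat list \<Rightarrow> nat list" where
  "gamma a b \<pi> = take (b - 1) \<pi> @ [\<pi> ! (a - 1)] @ drop (b - 1) (take (a - 1) \<pi>) @ drop a \<pi>"

definition identity_perm :: "nat list \<Rightarrow> bool" where
  "identity_perm \<pi> \<longleftrightarrow> \<pi> = [1..<length \<pi> + 1]"

text \<open>A word x_m ... x_1 is the list [x_m, ..., x_1] (written order); x_1 is applied first.\<close>
definition apply_word :: "('l \<Rightarrow> nat list \<Rightarrow> nat list option) \<Rightarrow> 'l list \<Rightarrow> nat list option" where
  "apply_word f w = foldr (\<lambda>x acc. Option.bind acc (f x)) w (Some [])"

definition language :: "('l \<Rightarrow> nat list \<Rightarrow> nat list option) \<Rightarrow> 'l list set" where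
  "language f = {w. w \<noteq> [] \<and> apply_word f w \<noteq> None}"

datatype rlet = One | Two | U | D

fun psiR :: "rlet \<Rightarrow> nat list \<Rightarrow> nat list option" where
  "psiR One \<pi> = (if rectangular \<pi> then Some (rho 1 1 \<pi>) else None)"
| "psiR Two \<pi> = (if rectangular \<pi> \<and> length \<pi> \<ge> 1 \<and> hd \<pi> \<noteq> 1
                   then Some (rho 1 2 \<pi>) else None)"
| "psiR U \<pi> = (if rectangular \<pi> \<and> length \<pi> \<ge> 1 \<and> hd \<pi> \<noteq> 1
                 then Some (rho (hd \<pi>) 1 \<pi>) else None)"
| "psiR D \<pi> = (if rectangular \<pi> \<and> length \<pi> \<ge> 1
                 then Some (rho (hd \<pi> + 1) 1 \<pi>) else None)"

definition L_Rect :: "rlet list set" where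
  "L_Rect = language psiR"

definition is_recoil :: "nat list \<Rightarrow> nat \<Rightarrow> bool" where
  "is_recoil \<pi> i \<longleftrightarrow> 1 \<le> i \<and> i < length \<pi> \<and>
     (\<exists>j k. j < k \<and> k < length \<pi> \<and> \<pi> ! j = i + 1 \<and> \<pi> ! k = i)"

definition smallest_recoil :: "nat list \<Rightarrow> nat" where
  "smallest_recoil \<pi> = (LEAST i. is_recoil \<pi> i)"

definition sandwiched :: "nat list \<Rightarrow> nat \<Rightarrow> nat \<Rightarrow> bool" where
  "sandwiched \<pi> a b \<longleftrightarrow> b \<ge> 1 \<and> a + b \<le> length \<pi> \<and>
     take a \<pi> = [1..<a + 1] \<and> drop (length \<pi> - b) \<pi> = [a + 1..<a + b + 1]"

definition psi_q :: "nat list \<Rightarrow> nat list" where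
  "psi_q \<pi> = (let n = length \<pi>; t = smallest_recoil \<pi> in
     if \<exists>a b. sandwiched \<pi> a b
     then (let (a, b) = (SOME ab. sandwiched \<pi> (fst ab) (snd ab))
           in gamma (n - b + 2) (a + 2) (rho (t + 1) 1 \<pi>))
     else rho (t + 1) 1 \<pi>)"

definition s_domain :: "nat list \<Rightarrow> bool" where
  "s_domain \<pi> \<longleftrightarrow> identity_perm \<pi> \<or>
     (\<exists>t \<ge> 1. t \<le> length \<pi> \<and> drop (length \<pi> - t) \<pi> = [1..<t + 1])"

datatype elet = P | Q | R | S

fun psiE :: "elet \<Rightarrow> nat list \<Rightarrow> nat list option" where
  "psiE P \<pi> = (if evil_avoiding \<pi> \<and> \<not> identity_perm \<pi> then Some (rho 1 1 \<pi>) else None)"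
| "psiE Q \<pi> = (if evil_avoiding \<pi> \<and> \<not> identity_perm \<pi> then Some (psi_q \<pi>) else None)"
| "psiE R \<pi> = (if evil_avoiding \<pi> \<and> length \<pi> \<ge> 1
                 then Some (rho 1 (length \<pi> + 1) \<pi>) else None)"
| "psiE S \<pi> = (if evil_avoiding \<pi> \<and> s_domain \<pi>
                 then Some (if \<pi> = [] then [1] else rho (last \<pi> + 1) (length \<pi> + 1) \<pi>)
                 else None)"

definition L_Evil :: "elet list set" where
  "L_Evil = language psiE"

fun subst_RE :: "rlet \<Rightarrow> elet" where
  "subst_RE Two = P" | "subst_RE U = Q" | "subst_RE D = R" | "subst_RE One = S"

fun subst_ER :: "elet \<Rightarrow> rlet" where
  "subst_ER P = Two" | "subst_ER Q = U" | "subst_ER R = D" | "subst_ER S = One"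

definition rev_before_last_R :: "elet list \<Rightarrow> elet list" where
  "rev_before_last_R w = (if R \<in> set w
     then (let k = (GREATEST i. i < length w \<and> w ! i = R) in rev (take k w) @ drop k w)
     else w)"

definition bmap :: "rlet list \<Rightarrow> elet list" where
  "bmap w = rev_before_last_R (map subst_RE w)"

definition bmap_inv :: "elet list \<Rightarrow> rlet list" where
  "bmap_inv w = map subst_ER (rev_before_last_R w)"

end

theory Submission
  imports Defs "HOL-Library.Sublist"
begin

text \<open>
  Both languages are regular. Every operator maps its domain into the respective permutation class,
  so only the other domain conditions matter. For rectangular permutations, the first entry is 1
  exactly when the last operator applied was the letter 1; hence a word lies in the language iff its
  rightmost letter is 1 and no 2 or u stands immediately to the left of a 1. For evil-avoiding
  permutations, the result is an identity exactly when no r was applied, and it lies in the domain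
  of s exactly when the last operator applied was r or s; hence a word lies in the language iff its
  rightmost letter is s, every p and q has an r somewhere to its right, and no s stands immediately
  to the left of a p or q. In both cases the rightmost r (respectively d) is followed by a nonempty
  block of s (respectively 1), and the forbidden factors of the part to its left are mirror images
  of each other, so reversing that part exchanges the two conditions.
\<close>

section \<open>Pattern occurrences\<close>

text \<open>The four forbidden patterns of a class are merged into one relation \<open>T\<close> on
  values, so that insertion arguments treat all of them at once.\<close>

definition avoid4 :: "(nat \<Rightarrow> nat \<Rightarrow> nat \<Rightarrow> nat \<Rightarrow> bool) \<Rightarrow> nat list \<Rightarrow> bool" where
  "avoid4 T \<pi> \<longleftrightarrow> (\<forall>i j k l. i < j \<longrightarrow> j < k \<longrightarrow> k < l \<longrightarrow> l < length \<pi> \<longrightarrow> \<not> T (\<pi> ! i) (\<pi> ! j) (\<pi> ! k) (\<pi> ! l))"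

text \<open>The disjuncts are 2413, 2431, 4213 and 4231, in this order. The first two roles always
  hold the ranks 2 and 4, the last two the ranks 1 and 3.\<close>

definition rect4 :: "nat \<Rightarrow> nat \<Rightarrow> nat \<Rightarrow> nat \<Rightarrow> bool" where
  "rect4 a b c d \<longleftrightarrow> c < a \<and> a < d \<and> d < b \<or> d < a \<and> a < c \<and> c < b
     \<or> c < b \<and> b < d \<and> d < a \<or> d < b \<and> b < c \<and> c < a"

text \<open>The disjuncts are 2413, 4132, 4213 and 3214, in this order.\<close>

definition evil4 :: "nat \<Rightarrow> nat \<Rightarrow> nat \<Rightarrow> nat \<Rightarrow> bool" where
  "evil4 a b c d \<longleftrightarrow> c < a \<and> a < d \<and> d < b \<or> b < d \<and> d < c \<and> c < a
     \<or> c < b \<and> b < d \<and> d < a \<or> c < b \<and> b < a \<and> a < d"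

text \<open>Splits off the first matched letter together with its position; four applications turn a
  subsequence of length four into four increasing indices.\<close>

lemma subseq_Cons_iff_nth:
  "subseq (y # ys) xs \<longleftrightarrow> (\<exists>i < length xs. xs ! i = y \<and> subseq ys (drop (Suc i) xs))"
proof (induction xs)
  case (Cons x xs)
  show ?case
  proof
    assume L: "subseq (y # ys) (x # xs)"
    show "\<exists>i < length (x # xs). (x # xs) ! i = y \<and> subseq ys (drop (Suc i) (x # xs))"
    proof (cases "x = y")
      case True
      with L have "subseq ys xs" by simp
      with True show ?thesis by (intro exI[of _ 0]) auto
    next
      case False
      with L have "subseq (y # ys) xs" by auto
      with Cons.IH obtain i where "i < length xs" "xs ! i = y" "subseq ys (drop (Suc i) xs)" by blast
      then show ?thesis by (intro exI[of _ "Suc i"]) auto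
    qed
  next
    assume "\<exists>i < length (x # xs). (x # xs) ! i = y \<and> subseq ys (drop (Suc i) (x # xs))"
    then obtain i where i: "i < length (x # xs)" "(x # xs) ! i = y" "subseq ys (drop (Suc i) (x # xs))"
      by blast
    show "subseq (y # ys) (x # xs)"
    proof (cases i)
      case 0
      with i show ?thesis by auto
    next
      case (Suc j)
      with i Cons.IH have "subseq (y # ys) xs" by auto
      then show ?thesis by (rule list_emb_Cons)
    qed
  qed
qed auto

lemma subseq4_iff_nth:
  "subseq [a, b, c, d] \<pi> \<longleftrightarrow> (\<exists>i j k l. i < j \<and> j < k \<and> k < l \<and> l < length \<pi> \<and>
     \<pi> ! i = a \<and> \<pi> ! j = b \<and> \<pi> ! k = c \<and> \<pi> ! l = d)" (is "?L \<longleftrightarrow> ?R")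
proof
  assume ?L
  then obtain i j k l where *: "i < length \<pi>" "\<pi> ! i = a"
    "j < length (drop (Suc i) \<pi>)" "drop (Suc i) \<pi> ! j = b"
    "k < length (drop (Suc j) (drop (Suc i) \<pi>))" "drop (Suc j) (drop (Suc i) \<pi>) ! k = c"
    "l < length (drop (Suc k) (drop (Suc j) (drop (Suc i) \<pi>)))"
    "drop (Suc k) (drop (Suc j) (drop (Suc i) \<pi>)) ! l = d"
    unfolding subseq_Cons_iff_nth by blast
  show ?R
    \<comment> \<open>Each obtained index is relative to the suffix behind the previous match; the
      witnesses are the absolute positions.\<close>
    by (rule exI[of _ i], rule exI[of _ "Suc i + j"], rule exI[of _ "Suc i + Suc j + k"],
        rule exI[of _ "Suc i + Suc j + Suc k + l"]) (use * in \<open>auto simp: add_ac\<close>)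
next
  assume ?R
  then obtain i j k l where *: "i < j" "j < k" "k < l" "l < length \<pi>"
     "\<pi> ! i = a" "\<pi> ! j = b" "\<pi> ! k = c" "\<pi> ! l = d" by blast
  have "subseq [d] (drop (Suc k) \<pi>)"
    unfolding subseq_Cons_iff_nth[of d] using * by (intro exI[of _ "l - Suc k"]) auto
  then have "subseq [c, d] (drop (Suc j) \<pi>)"
    unfolding subseq_Cons_iff_nth[of c] using * by (intro exI[of _ "k - Suc j"]) auto
  then have "subseq [b, c, d] (drop (Suc i) \<pi>)"
    unfolding subseq_Cons_iff_nth[of b] using * by (intro exI[of _ "j - Suc i"]) auto
  then show ?L
    unfolding subseq_Cons_iff_nth[of a] using * by (intro exI[of _ i]) auto
qed

lemma avoid4_iff_subseq:
  "avoid4 T \<pi> \<longleftrightarrow> (\<forall>a b c d. subseq [a, b, c, d] \<pi> \<longrightarrow> \<not> T a b c d)"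
  unfolding avoid4_def subseq4_iff_nth by blast

lemma contains4_iff:
  "contains \<pi> [p, q, r, s] \<longleftrightarrow> (\<exists>a b c d. subseq [a, b, c, d] \<pi> \<and> order_iso [a, b, c, d] [p, q, r, s])"
proof -
  have "\<exists>a b c d. x = [a, b, c, d]" if "order_iso x [p, q, r, s]" for x
    using that by (auto simp: order_iso_def length_Suc_conv)
  then show ?thesis
    unfolding contains_def by (metis in_set_subseqs)
qed

lemma all_less_4: "(\<forall>i < (4::nat). A i) \<longleftrightarrow> A 0 \<and> A 1 \<and> A 2 \<and> A 3"
  by (auto simp: numeral_eq_Suc less_Suc_eq)

lemma order_iso4:
  "order_iso [a, b, c, d] [p, q, r, s] \<longleftrightarrow>
     (a < b \<longleftrightarrow> p < q) \<and> (a < c \<longleftrightarrow> p < r) \<and> (a < d \<longleftrightarrow> p < s) \<and>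
     (b < a \<longleftrightarrow> q < p) \<and> (b < c \<longleftrightarrow> q < r) \<and> (b < d \<longleftrightarrow> q < s) \<and>
     (c < a \<longleftrightarrow> r < p) \<and> (c < b \<longleftrightarrow> r < q) \<and> (c < d \<longleftrightarrow> r < s) \<and>
     (d < a \<longleftrightarrow> s < p) \<and> (d < b \<longleftrightarrow> s < q) \<and> (d < c \<longleftrightarrow> s < r)"
proof -
  have "length [a, b, c, d] = 4" "length [p, q, r, s] = 4" by auto
  then show ?thesis
    unfolding order_iso_def all_less_4 by (simp only: all_less_4) (simp add: numeral_eq_Suc)
qed

lemma order_iso_patterns:
  "order_iso [a, b, c, d] [2,4,1,3] \<longleftrightarrow> c < a \<and> a < d \<and> d < b"
  "order_iso [a, b, c, d] [2,4,3,1] \<longleftrightarrow> d < a \<and> a < c \<and> c < b"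
  "order_iso [a, b, c, d] [4,2,1,3] \<longleftrightarrow> c < b \<and> b < d \<and> d < a"
  "order_iso [a, b, c, d] [4,2,3,1] \<longleftrightarrow> d < b \<and> b < c \<and> c < a"
  "order_iso [a, b, c, d] [4,1,3,2] \<longleftrightarrow> b < d \<and> d < c \<and> c < a"
  "order_iso [a, b, c, d] [3,2,1,4] \<longleftrightarrow> c < b \<and> b < a \<and> a < d"
  by (auto simp: order_iso4)

lemma rectangular_iff: "rectangular \<pi> \<longleftrightarrow> avoid4 rect4 \<pi>"
proof -
  have "rect4 a b c d \<longleftrightarrow> order_iso [a, b, c, d] [2,4,1,3] \<or> order_iso [a, b, c, d] [2,4,3,1] \<or>
     order_iso [a, b, c, d] [4,2,1,3] \<or> order_iso [a, b, c, d] [4,2,3,1]" for a b c d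
    by (simp only: rect4_def order_iso_patterns)
  then show ?thesis
    unfolding rectangular_def avoids_def contains4_iff avoid4_iff_subseq by blast
qed

lemma evil_avoiding_iff: "evil_avoiding \<pi> \<longleftrightarrow> avoid4 evil4 \<pi>"
proof -
  have "evil4 a b c d \<longleftrightarrow> order_iso [a, b, c, d] [2,4,1,3] \<or> order_iso [a, b, c, d] [4,1,3,2] \<or>
     order_iso [a, b, c, d] [4,2,1,3] \<or> order_iso [a, b, c, d] [3,2,1,4]" for a b c d
    by (simp only: evil4_def order_iso_patterns)
  then show ?thesis
    unfolding evil_avoiding_def avoids_def contains4_iff avoid4_iff_subseq by blast
qed

text \<open>An occurrence that is not already in the tail must use the new front entry in its first
  role.\<close>

lemma avoid4_Cons:
  "avoid4 T (x # \<pi>) \<longleftrightarrow> avoid4 T \<pi> \<and>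
     (\<forall>j k l. j < k \<longrightarrow> k < l \<longrightarrow> l < length \<pi> \<longrightarrow> \<not> T x (\<pi> ! j) (\<pi> ! k) (\<pi> ! l))" (is "?L \<longleftrightarrow> ?A \<and> ?B")
proof
  assume L: ?L
  have ?A unfolding avoid4_def
  proof (intro allI impI)
    fix i j k l assume "i < j" "j < k" "k < l" "l < length \<pi>"
    then show "\<not> T (\<pi> ! i) (\<pi> ! j) (\<pi> ! k) (\<pi> ! l)"
      using L[unfolded avoid4_def, rule_format, of "Suc i" "Suc j" "Suc k" "Suc l"] by simp
  qed
  moreover have ?B
  proof (intro allI impI)
    fix j k l assume "j < k" "k < l" "l < length \<pi>"
    then show "\<not> T x (\<pi> ! j) (\<pi> ! k) (\<pi> ! l)"
      using L[unfolded avoid4_def, rule_format, of 0 "Suc j" "Suc k" "Suc l"] by simp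
  qed
  ultimately show "?A \<and> ?B" ..
next
  assume AB: "?A \<and> ?B"
  show ?L unfolding avoid4_def
  proof (intro allI impI)
    fix i j k l assume *: "i < j" "j < k" "k < l" "l < length (x # \<pi>)"
    then obtain j' k' l' where [simp]: "j = Suc j'" "k = Suc k'" "l = Suc l'"
      by (metis Nat.lessE)
    show "\<not> T ((x # \<pi>) ! i) ((x # \<pi>) ! j) ((x # \<pi>) ! k) ((x # \<pi>) ! l)"
      using AB * by (cases i) (auto simp: avoid4_def)
  qed
qed

text \<open>Mirror image of \<open>avoid4_Cons\<close>: an appended entry can only play the last
  role.\<close>

lemma avoid4_snoc:
  "avoid4 T (\<pi> @ [x]) \<longleftrightarrow> avoid4 T \<pi> \<and>
     (\<forall>i j k. i < j \<longrightarrow> j < k \<longrightarrow> k < length \<pi> \<longrightarrow> \<not> T (\<pi> ! i) (\<pi> ! j) (\<pi> ! k) x)" (is "?L \<longleftrightarrow> ?A \<and> ?B")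
proof
  assume L: ?L
  have ?A unfolding avoid4_def
  proof (intro allI impI)
    fix i j k l assume "i < j" "j < k" "k < l" "l < length \<pi>"
    then show "\<not> T (\<pi> ! i) (\<pi> ! j) (\<pi> ! k) (\<pi> ! l)"
      using L[unfolded avoid4_def, rule_format, of i j k l] by (simp add: nth_append)
  qed
  moreover have ?B
  proof (intro allI impI)
    fix i j k assume "i < j" "j < k" "k < length \<pi>"
    then show "\<not> T (\<pi> ! i) (\<pi> ! j) (\<pi> ! k) x"
      using L[unfolded avoid4_def, rule_format, of i j k "length \<pi>"] by (simp add: nth_append)
  qed
  ultimately show "?A \<and> ?B" ..
next
  assume AB: "?A \<and> ?B"
  show ?L unfolding avoid4_def
  proof (intro allI impI)
    fix i j k l assume *: "i < j" "j < k" "k < l" "l < length (\<pi> @ [x])"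
    show "\<not> T ((\<pi> @ [x]) ! i) ((\<pi> @ [x]) ! j) ((\<pi> @ [x]) ! k) ((\<pi> @ [x]) ! l)"
      using AB * by (cases "l = length \<pi>") (auto simp: avoid4_def nth_append)
  qed
qed

section \<open>Order-preserving relabelling and insertion at the ends\<close>

definition shift :: "nat \<Rightarrow> nat \<Rightarrow> nat" where
  "shift i x = (if x \<ge> i then x + 1 else x)"

lemma shift_less_iff [simp]: "shift i x < shift i y \<longleftrightarrow> x < y"
  by (auto simp: shift_def)

lemma distinct_map_shift [simp]: "distinct (map (shift i) \<pi>) \<longleftrightarrow> distinct \<pi>"
  by (auto simp: distinct_map inj_on_def shift_def)

lemma shift_pos [simp]: "0 < x \<Longrightarrow> 0 < shift i x"
  by (simp add: shift_def)

lemma shift_neq [simp]: "shift i x \<noteq> i" "i \<noteq> shift i x"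
  by (auto simp: shift_def)

lemma shift_eq_iff [simp]: "shift i x = shift i y \<longleftrightarrow> x = y"
  by (auto simp: shift_def)

lemma rho_first: "rho i (Suc 0) \<pi> = i # map (shift i) \<pi>"
  by (simp add: rho_def shift_def[abs_def])

lemma rho_last: "rho i (Suc (length \<pi>)) \<pi> = map (shift i) \<pi> @ [i]"
  by (simp add: rho_def shift_def[abs_def])

text \<open>Both relations only compare values, and \<open>shift i\<close> is strictly
  increasing.\<close>

lemma avoid4_map_shift:
  assumes "T = rect4 \<or> T = evil4"
  shows "avoid4 T (map (shift i) \<pi>) \<longleftrightarrow> avoid4 T \<pi>"
  using assms unfolding avoid4_def by (elim disjE) (auto simp: rect4_def evil4_def)

section \<open>The rectangular language\<close>

text \<open>The first two roles have ranks 2 and 4, so neither can be the minimum. This is why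
  inserting a 1 at position 1 or 2 is harmless.\<close>

lemma not_rect4_1 [simp]:
  "0 < c \<Longrightarrow> 0 < d \<Longrightarrow> \<not> rect4 (Suc 0) b c d"
  "0 < c \<Longrightarrow> 0 < d \<Longrightarrow> \<not> rect4 a (Suc 0) c d"
  by (auto simp: rect4_def)

lemma rectangular_rho_1_1:
  assumes "rectangular \<pi>" "0 \<notin> set \<pi>"
  shows "rectangular (rho 1 1 \<pi>)"
proof -
  have "\<pi> ! i > 0" if "i < length \<pi>" for i
    using assms(2) that by (metis gr0I nth_mem)
  then show ?thesis
    using assms by (auto simp: rectangular_iff rho_first avoid4_Cons avoid4_map_shift)
qed

text \<open>The new 1 stands at position 2, so it could only play the first or second role, where a
  minimum is impossible. Occurrences without it come from \<open>h # \<pi>\<close>. The old first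
  entry rises to \<open>Suc h\<close>, so the result does not start with 1.\<close>

lemma rectangular_rho_1_2:
  assumes "rectangular (h # \<pi>)" "0 \<notin> set (h # \<pi>)"
  shows "rectangular (rho 1 2 (h # \<pi>))" "hd (rho 1 2 (h # \<pi>)) = Suc h" "0 \<notin> set (rho 1 2 (h # \<pi>))"
proof -
  have pos: "\<pi> ! i > 0" if "i < length \<pi>" for i
    using assms(2) that by (metis gr0I list.set_intros(2) nth_mem)
  have eq: "rho 1 2 (h # \<pi>) = shift 1 h # 1 # map (shift 1) \<pi>"
    by (simp add: rho_def shift_def[abs_def] numeral_2_eq_2)
  from assms(2) have h: "h > 0" by simp
  have A: "avoid4 rect4 (map (shift 1) \<pi>)"
    using assms(1) by (simp add: rectangular_iff avoid4_map_shift avoid4_Cons)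
  have B: "\<not> rect4 (shift 1 h) (map (shift 1) \<pi> ! j) (map (shift 1) \<pi> ! k) (map (shift 1) \<pi> ! l)"
    if "j < k" "k < l" "l < length \<pi>" for j k l
    using assms(1) that avoid4_map_shift[of rect4 1 "h # \<pi>"] unfolding rectangular_iff
    by (simp add: avoid4_Cons)
  show "rectangular (rho 1 2 (h # \<pi>))"
    unfolding eq rectangular_iff avoid4_Cons[of _ 1]  avoid4_Cons[of _ "shift 1 h"]
  proof (intro conjI allI impI)
    fix j k l :: nat assume *: "j < k" "k < l" "l < length (1 # map (shift 1) \<pi>)"
    then obtain k' l' where [simp]: "k = Suc k'" "l = Suc l'" by (metis Nat.lessE)
    show "\<not> rect4 (shift 1 h) ((1 # map (shift 1) \<pi>) ! j) ((1 # map (shift 1) \<pi>) ! k) ((1 # map (shift 1) \<pi>) ! l)"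
    proof (cases j)
      case 0
      with * h show ?thesis by (auto simp: pos)
    next
      case (Suc j')
      with * B[of j' k' l'] show ?thesis by simp
    qed
  qed (use A in \<open>auto simp: pos\<close>)
  show "hd (rho 1 2 (h # \<pi>)) = Suc h" "0 \<notin> set (rho 1 2 (h # \<pi>))"
    unfolding eq using assms(2) by (auto simp: shift_def)
qed

text \<open>The inserted entry and the old first entry are adjacent both in position and in value, so an
  occurrence using both would need consecutive values in the roles 2 and 4.\<close>

lemma rectangular_dup_first:
  assumes "rectangular (h # \<pi>)" "g = h \<or> g = Suc h" "h \<notin> set \<pi>"
  shows "rectangular (rho g 1 (h # \<pi>))"
proof -
  have A: "avoid4 rect4 (map (shift g) (h # \<pi>))"
    using assms(1) by (simp add: rectangular_iff avoid4_map_shift del: list.map)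
  have n: "\<not> rect4 g (shift g h) (shift g x) (shift g y)" for x y
    using assms(2) by (auto simp: rect4_def shift_def split: if_splits)
  \<comment> \<open>Every value other than \<open>h\<close> compares with the new entry as with the
    relabelled \<open>h\<close>, so an occurrence starting at the new entry but missing
    \<open>h\<close> can start at \<open>h\<close> instead.\<close>
  have c: "g < shift g x \<longleftrightarrow> shift g h < shift g x" "shift g x < g \<longleftrightarrow> shift g x < shift g h" if "x \<noteq> h" for x
    using that assms(2) by (auto simp: shift_def)
  have s: "rect4 (shift g h) (shift g x) (shift g y) (shift g z)"
    if "rect4 g (shift g x) (shift g y) (shift g z)" "x \<noteq> h" "y \<noteq> h" "z \<noteq> h" for x y z
    using that(1) c[OF that(2)] c[OF that(3)] c[OF that(4)] unfolding rect4_def by metis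
  have ne: "\<pi> ! i \<noteq> h" if "i < length \<pi>" for i
    using assms(3) that by (metis nth_mem)
  show ?thesis
    unfolding rectangular_iff One_nat_def rho_first avoid4_Cons[of _ g]
  proof (intro conjI allI impI)
    fix j k l :: nat assume *: "j < k" "k < l" "l < length (map (shift g) (h # \<pi>))"
    then obtain k' l' where [simp]: "k = Suc k'" "l = Suc l'" by (metis Nat.lessE)
    show "\<not> rect4 g (map (shift g) (h # \<pi>) ! j) (map (shift g) (h # \<pi>) ! k) (map (shift g) (h # \<pi>) ! l)"
    proof (cases j)
      case 0
      with * n show ?thesis by auto
    next
      case (Suc j')
      with * have "\<not> rect4 (shift g h) (shift g (\<pi> ! j')) (shift g (\<pi> ! k')) (shift g (\<pi> ! l'))"
        using A by (simp add: avoid4_Cons)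
      with Suc * s[of "\<pi> ! j'" "\<pi> ! k'" "\<pi> ! l'"] ne[of j'] ne[of k'] ne[of l'] show ?thesis by auto
    qed
  qed (rule A)
qed

section \<open>Words of rectangular operators\<close>

text \<open>Words are in written order, so \<open>hd w\<close> is the operator applied just before
  \<open>x\<close>; the test on it stands for the domain condition that the first entry differs from
  1.\<close>

fun rect_word :: "rlet list \<Rightarrow> bool" where
  "rect_word [] \<longleftrightarrow> True"
| "rect_word (x # w) \<longleftrightarrow> rect_word w \<and> (if w = [] then x = One else x \<in> {Two, U} \<longrightarrow> hd w \<noteq> One)"

lemma apply_word_Nil [simp]: "apply_word f [] = Some []"
  by (simp add: apply_word_def)

lemma apply_word_Cons [simp]: "apply_word f (x # w) = Option.bind (apply_word f w) (f x)"
  by (simp add: apply_word_def)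

text \<open>Whether the first entry is 1 is all that a later operator can see, and the letter just
  applied decides it: \<open>Two\<close> and \<open>D\<close> produce \<open>Suc h\<close>, while
  \<open>U\<close> keeps \<open>h\<close>, which its domain makes different from 1.\<close>

lemma psiR_step:
  assumes "rectangular (h # \<pi>)" "0 \<notin> set (h # \<pi>)" "distinct (h # \<pi>)"
  shows "(psiR x (h # \<pi>) \<noteq> None) \<longleftrightarrow> (x \<in> {Two, U} \<longrightarrow> h \<noteq> 1)"
    and "psiR x (h # \<pi>) = Some \<sigma> \<Longrightarrow>
      rectangular \<sigma> \<and> 0 \<notin> set \<sigma> \<and> distinct \<sigma> \<and> \<sigma> \<noteq> [] \<and> (hd \<sigma> = 1 \<longleftrightarrow> x = One)"
proof -
  show "(psiR x (h # \<pi>) \<noteq> None) \<longleftrightarrow> (x \<in> {Two, U} \<longrightarrow> h \<noteq> 1)"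
    using assms(1) by (cases x) auto
  assume *: "psiR x (h # \<pi>) = Some \<sigma>"
  have h: "h > 0" using assms(2) by simp
  show "rectangular \<sigma> \<and> 0 \<notin> set \<sigma> \<and> distinct \<sigma> \<and> \<sigma> \<noteq> [] \<and> (hd \<sigma> = 1 \<longleftrightarrow> x = One)"
  proof (cases x)
    case One
    with * assms(1) have "\<sigma> = rho 1 1 (h # \<pi>)" by simp
    with One rectangular_rho_1_1[OF assms(1,2)] assms(2,3) show ?thesis
      by (auto simp: rho_first image_iff) (auto simp: shift_def Suc_le_eq intro!: gr0I)
  next
    case Two
    with * assms(1) have s: "\<sigma> = rho 1 2 (h # \<pi>)" by (simp split: if_splits)
    have s': "\<sigma> = shift 1 h # 1 # map (shift 1) \<pi>"
      by (simp add: s rho_def shift_def[abs_def] numeral_2_eq_2)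
    have "distinct \<sigma>" using assms(2,3) unfolding s' by (auto simp: shift_def)
    moreover have "\<sigma> \<noteq> []" by (simp add: s')
    ultimately show ?thesis
      using Two s rectangular_rho_1_2[OF assms(1,2)] h by simp
  next
    case U
    with * assms(1) have s: "\<sigma> = rho h 1 (h # \<pi>)" "h \<noteq> 1" by (simp_all split: if_splits)
    with U rectangular_dup_first[OF assms(1), of h] h assms(2,3) show ?thesis
      by (auto simp: rho_first image_iff) (auto simp: shift_def Suc_le_eq intro!: gr0I)
  next
    case D
    with * assms(1) have s: "\<sigma> = rho (Suc h) 1 (h # \<pi>)" by (simp split: if_splits)
    with D rectangular_dup_first[OF assms(1), of "Suc h"] h assms(2,3) show ?thesis
      by (auto simp: rho_first image_iff) (auto simp: shift_def Suc_le_eq intro!: gr0I)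
  qed
qed

lemma apply_word_psiR:
  "(apply_word psiR w \<noteq> None \<longleftrightarrow> rect_word w) \<and>
   (\<forall>\<pi>. apply_word psiR w = Some \<pi> \<longrightarrow> w \<noteq> [] \<longrightarrow>
      rectangular \<pi> \<and> 0 \<notin> set \<pi> \<and> distinct \<pi> \<and> \<pi> \<noteq> [] \<and> (hd \<pi> = 1 \<longleftrightarrow> hd w = One))"
proof (induction w)
  case (Cons x w)
  show ?case
  proof (cases "w = []")
    case True
    have "rectangular []" "rectangular [Suc 0]" by (auto simp: rectangular_iff avoid4_def)
    then show ?thesis using True by (cases x) (auto simp: rho_first)
  next
    case False
    show ?thesis
    proof (cases "apply_word psiR w")
      case None
      with Cons False show ?thesis by auto
    next
      case (Some \<pi>)
      with Cons False have inv: "rectangular \<pi>" "0 \<notin> set \<pi>" "distinct \<pi>" "\<pi> \<noteq> []" "hd \<pi> = 1 \<longleftrightarrow> hd w = One"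
        and "rect_word w" by auto
      moreover obtain h \<pi>' where "\<pi> = h # \<pi>'" using inv by (cases \<pi>) auto
      ultimately show ?thesis
        using psiR_step[of h \<pi>' x] Some False by auto
    qed
  qed
qed simp

lemma L_Rect_iff: "w \<in> L_Rect \<longleftrightarrow> w \<noteq> [] \<and> rect_word w"
  using apply_word_psiR[of w] by (simp add: L_Rect_def language_def)


section \<open>The evil-avoiding language\<close>

definition is_perm :: "nat list \<Rightarrow> bool" where
  "is_perm \<pi> \<longleftrightarrow> distinct \<pi> \<and> set \<pi> = {1..length \<pi>}"

text \<open>Values from \<open>i\<close> on move up by one, and \<open>i\<close> fills the gap this
  leaves.\<close>

lemma shift_image:
  assumes "1 \<le> i" "i \<le> Suc n"
  shows "insert i (shift i ` {1..n}) = {1..Suc n}"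
proof
  show "insert i (shift i ` {1..n}) \<subseteq> {1..Suc n}"
    using assms by (auto simp: shift_def)
  show "{1..Suc n} \<subseteq> insert i (shift i ` {1..n})"
  proof
    fix x assume x: "x \<in> {1..Suc n}"
    consider "x = i" | "x < i" | "x > i" by linarith
    then show "x \<in> insert i (shift i ` {1..n})"
    proof cases
      case 2
      with x assms have "x = shift i x" "x \<in> {1..n}" by (auto simp: shift_def)
      then show ?thesis by blast
    next
      case 3
      with x assms have "x = shift i (x - 1)" "x - 1 \<in> {1..n}" by (auto simp: shift_def)
      then show ?thesis by blast
    qed simp
  qed
qed

lemma is_perm_insert:
  assumes "is_perm \<pi>" "1 \<le> i" "i \<le> Suc (length \<pi>)"
  shows "is_perm (i # map (shift i) \<pi>)" "is_perm (map (shift i) \<pi> @ [i])"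
  using assms shift_image[of i "length \<pi>"] by (auto simp: is_perm_def)

lemma is_perm_nth:
  assumes "is_perm \<pi>" "i < length \<pi>"
  shows "1 \<le> \<pi> ! i" "\<pi> ! i \<le> length \<pi>"
  using assms nth_mem[of i \<pi>] by (auto simp: is_perm_def)

lemma is_perm_nth_inj:
  assumes "is_perm \<pi>" "i < length \<pi>" "j < length \<pi>" "\<pi> ! i = \<pi> ! j"
  shows "i = j"
  using assms by (auto simp: is_perm_def nth_eq_iff_index_eq)

lemma is_perm_obtain_index:
  assumes "is_perm \<pi>" "1 \<le> v" "v \<le> length \<pi>"
  obtains i where "i < length \<pi>" "\<pi> ! i = v"
  using assms by (metis atLeastAtMost_iff in_set_conv_nth is_perm_def)

lemma identity_perm_evil:
  assumes "identity_perm \<pi>"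
  shows "evil_avoiding \<pi>"
proof -
  have "avoid4 evil4 [1..<Suc n]" for n
    by (auto simp: avoid4_def evil4_def simp del: upt_Suc)
  then show ?thesis using assms unfolding identity_perm_def evil_avoiding_iff by (metis Suc_eq_plus1)
qed

text \<open>In each of the four patterns the first entry exceeds the third, so a minimum cannot come
  first.\<close>

lemma evil_insert_1_first:
  assumes "is_perm \<pi>" "evil_avoiding \<pi>"
  shows "evil_avoiding (1 # map (shift 1) \<pi>)"
proof -
  have "\<not> evil4 (Suc 0) b c d" if "c > 0" for b c d
    using that by (auto simp: evil4_def)
  moreover have "\<pi> ! i > 0" if "i < length \<pi>" for i
    using is_perm_nth[OF assms(1) that] by simp
  ultimately show ?thesis
    using assms(2) by (auto simp: evil_avoiding_iff avoid4_Cons avoid4_map_shift)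
qed

text \<open>None of the four patterns ends in its minimum.\<close>

lemma evil_insert_1_last:
  assumes "is_perm \<pi>" "evil_avoiding \<pi>"
  shows "evil_avoiding (map (shift 1) \<pi> @ [1])"
proof -
  have "\<not> evil4 a b c (Suc 0)" if "b > 0" for a b c
    using that by (auto simp: evil4_def)
  moreover have "\<pi> ! i > 0" if "i < length \<pi>" for i
    using is_perm_nth[OF assms(1) that] by simp
  ultimately show ?thesis
    using assms(2) by (auto simp: evil_avoiding_iff avoid4_snoc avoid4_map_shift)
qed

text \<open>The suffix already uses up all values up to \<open>t\<close>, and each value occurs
  once, so these values sit exactly at the last \<open>t\<close> positions.\<close>

lemma suffix_upt_nth:
  assumes "is_perm \<pi>" "t \<le> length \<pi>" "drop (length \<pi> - t) \<pi> = [1..<t + 1]" "j < length \<pi>"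
  shows "length \<pi> - t \<le> j \<Longrightarrow> \<pi> ! j = Suc j - (length \<pi> - t)"
    and "\<pi> ! j \<le> t \<longleftrightarrow> length \<pi> - t \<le> j"
proof -
  have v: "\<pi> ! i = Suc i - (length \<pi> - t)" if "length \<pi> - t \<le> i" "i < length \<pi>" for i
  proof -
    have "\<pi> ! i = drop (length \<pi> - t) \<pi> ! (i - (length \<pi> - t))"
      using that by simp
    also have "\<dots> = Suc i - (length \<pi> - t)"
      unfolding assms(3) using that assms(2) by (simp del: upt_Suc)
    finally show ?thesis .
  qed
  then show "length \<pi> - t \<le> j \<Longrightarrow> \<pi> ! j = Suc j - (length \<pi> - t)" using assms(4) by simp
  show "\<pi> ! j \<le> t \<longleftrightarrow> length \<pi> - t \<le> j"
  proof
    assume "length \<pi> - t \<le> j"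
    with v[of j] assms(2,4) show "\<pi> ! j \<le> t" by simp
  next
    assume t: "\<pi> ! j \<le> t"
    \<comment> \<open>The position at which the suffix holds the value
      \<open>\<pi> ! j\<close>.\<close>
    define i where "i = length \<pi> - t + (\<pi> ! j - 1)"
    have "1 \<le> \<pi> ! j" using is_perm_nth assms by blast
    then have "i < length \<pi>" "length \<pi> - t \<le> i" "\<pi> ! i = \<pi> ! j"
      using t assms(2) v[of i] by (auto simp: i_def)
    then show "length \<pi> - t \<le> j" using is_perm_nth_inj assms(1,4) by metis
  qed
qed

text \<open>The values up to \<open>t\<close> form an increasing final block. With
  \<open>Suc t\<close> in the last role, 2413, 4213 and 3214 would require a descent inside this
  block, and 4132 a larger value after one of its entries.\<close>

lemma evil_insert_after_suffix:
  assumes "is_perm \<pi>" "evil_avoiding \<pi>" "t \<le> length \<pi>" "drop (length \<pi> - t) \<pi> = [1..<t + 1]"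
  shows "evil_avoiding (map (shift (Suc t)) \<pi> @ [Suc t])"
proof -
  have inc: "\<pi> ! i < \<pi> ! j \<and> \<pi> ! j \<le> t" if "i < j" "j < length \<pi>" "\<pi> ! i \<le> t" for i j
  proof -
    have i: "length \<pi> - t \<le> i" using suffix_upt_nth(2)[OF assms(1,3,4), of i] that by simp
    then show ?thesis
      using suffix_upt_nth[OF assms(1,3,4), of i] suffix_upt_nth[OF assms(1,3,4), of j] that by simp arith
  qed
  have sh: "shift (Suc t) x < Suc t \<longleftrightarrow> x \<le> t" "Suc t < shift (Suc t) x \<longleftrightarrow> \<not> x \<le> t" for x
    by (auto simp: shift_def)
  have "\<not> evil4 (map (shift (Suc t)) \<pi> ! i) (map (shift (Suc t)) \<pi> ! j) (map (shift (Suc t)) \<pi> ! k) (Suc t)"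
    if "i < j" "j < k" "k < length \<pi>" for i j k
  proof -
    have "\<pi> ! i \<le> t \<Longrightarrow> \<pi> ! i < \<pi> ! k" "\<pi> ! j \<le> t \<Longrightarrow> \<pi> ! j < \<pi> ! k" "\<pi> ! j \<le> t \<Longrightarrow> \<pi> ! k \<le> t"
      using inc that by (metis order.strict_trans)+
    then show ?thesis using that unfolding evil4_def by (auto simp: sh)
  qed
  then show ?thesis
    using assms(2) by (auto simp: evil_avoiding_iff avoid4_snoc avoid4_map_shift)
qed

section \<open>Recoils\<close>

text \<open>Without a recoil below \<open>t\<close>, each value \<open>i < t\<close> stands before
  \<open>i + 1\<close>; chaining these comparisons puts all values up to \<open>t\<close> in
  increasing order.\<close>

lemma no_recoil_increasing:
  assumes "is_perm \<pi>" "\<And>i. i < t \<Longrightarrow> \<not> is_recoil \<pi> i" "t \<le> length \<pi>" "j < length \<pi>"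
  shows "k < length \<pi> \<Longrightarrow> \<pi> ! k = v \<Longrightarrow> v \<le> t \<Longrightarrow> \<pi> ! j < v \<Longrightarrow> j < k"
proof (induction v arbitrary: k)
  case (Suc v)
  have ge: "1 \<le> \<pi> ! j" using is_perm_nth assms by blast
  have "1 \<le> v" "v \<le> length \<pi>" using Suc.prems ge assms(3) by auto
  then obtain m where m: "m < length \<pi>" "\<pi> ! m = v"
    using is_perm_obtain_index[OF assms(1)] by metis
  have "\<not> is_recoil \<pi> v" using assms(2) Suc.prems by simp
  then have "\<not> k < m" unfolding is_recoil_def using m Suc.prems assms(3) ge by auto
  moreover have "k \<noteq> m" using m Suc.prems by auto
  moreover have "j \<le> m"
  proof (cases "\<pi> ! j = v")
    case True
    with m is_perm_nth_inj[OF assms(1,4) m(1)] show ?thesis by simp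
  next
    case False
    with Suc.IH[OF m] Suc.prems show ?thesis by simp
  qed
  ultimately show ?case by simp
qed simp

text \<open>Without recoils the list is sorted, hence the identity. So the \<open>LEAST\<close> in
  \<open>smallest_recoil\<close> is attained off the identities.\<close>

lemma recoil_exists:
  assumes "is_perm \<pi>" "\<not> identity_perm \<pi>"
  shows "\<exists>i. is_recoil \<pi> i"
proof (rule ccontr)
  assume "\<not> ?thesis"
  then have inc: "j < k" if "j < length \<pi>" "k < length \<pi>" "\<pi> ! j < \<pi> ! k" for j k
    using no_recoil_increasing[OF assms(1), of "length \<pi>" j k] that is_perm_nth[OF assms(1), of k] by simp
  have "\<pi> ! j \<le> \<pi> ! k" if "j < k" "k < length \<pi>" for j k
    using inc[of k j] that by linarith
  then have "sorted \<pi>" by (simp add: sorted_iff_nth_mono_less)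
  moreover have "distinct \<pi>" using assms(1) by (simp add: is_perm_def)
  moreover have "sorted [1..<length \<pi> + 1]" "distinct [1..<length \<pi> + 1]"
    by (simp_all del: upt_Suc)
  moreover have "set \<pi> = set [1..<length \<pi> + 1]"
    using assms(1) unfolding is_perm_def set_upt by (metis Suc_eq_plus1 atLeastLessThanSuc_atLeastAtMost)
  ultimately have "\<pi> = [1..<length \<pi> + 1]"
    by (rule sorted_distinct_set_unique)
  then show False using assms(2) by (simp add: identity_perm_def)
qed

lemma smallest_recoil:
  assumes "is_perm \<pi>" "\<not> identity_perm \<pi>"
  shows "is_recoil \<pi> (smallest_recoil \<pi>)" "i < smallest_recoil \<pi> \<Longrightarrow> \<not> is_recoil \<pi> i"
  unfolding smallest_recoil_def by (rule LeastI_ex[OF recoil_exists[OF assms]], rule not_less_Least)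

text \<open>The values up to t appear in increasing order, which rules out every role of the new entry except
  the 2 in 2413; in that case the entries t + 1 and t, in this order, complete a forbidden pattern.\<close>

lemma evil_insert_recoil:
  assumes "is_perm \<pi>" "evil_avoiding \<pi>" "is_recoil \<pi> t" "\<And>i. i < t \<Longrightarrow> \<not> is_recoil \<pi> i"
  shows "evil_avoiding (Suc t # map (shift (Suc t)) \<pi>)"
proof -
  obtain p q where pq: "p < q" "q < length \<pi>" "\<pi> ! p = Suc t" "\<pi> ! q = t" and t: "1 \<le> t" "t < length \<pi>"
    using assms(3) by (auto simp: is_recoil_def)
  have inc: "\<not> (\<pi> ! y < \<pi> ! x \<and> \<pi> ! x \<le> t)" if "x < y" "y < length \<pi>" for x y
    using no_recoil_increasing[OF assms(1,4), where j=y and k=x] that t by fastforce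
  have av: "\<not> evil4 (\<pi> ! i) (\<pi> ! j) (\<pi> ! k) (\<pi> ! l)" if "i < j" "j < k" "k < l" "l < length \<pi>" for i j k l
    using assms(2) that unfolding evil_avoiding_iff avoid4_def by blast
  have sh: "shift (Suc t) x < Suc t \<longleftrightarrow> x \<le> t" "Suc t < shift (Suc t) x \<longleftrightarrow> Suc t \<le> x" for x
    by (auto simp: shift_def)
  have "\<not> evil4 (Suc t) (map (shift (Suc t)) \<pi> ! j) (map (shift (Suc t)) \<pi> ! k) (map (shift (Suc t)) \<pi> ! l)"
    if jkl: "j < k" "k < l" "l < length \<pi>" for j k l
  proof
    assume "evil4 (Suc t) (map (shift (Suc t)) \<pi> ! j) (map (shift (Suc t)) \<pi> ! k) (map (shift (Suc t)) \<pi> ! l)"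
    then have c: "\<pi> ! k \<le> t" "Suc t \<le> \<pi> ! l" "\<pi> ! l < \<pi> ! j"
      using inc[of j k] inc[of k l] inc[of j l] jkl unfolding evil4_def by (auto simp: sh)
    have "p \<noteq> j" "p \<noteq> k" using pq c by auto
    \<comment> \<open>The position of the value \<open>Suc t\<close> decides which pattern arises in
      \<open>\<pi>\<close>: before \<open>j\<close> it is the 2 of a 2413, between \<open>j\<close>
      and \<open>k\<close> the 2 of a 4213, and after \<open>k\<close> it is the 3 of a 4132 whose 2
      is the value \<open>t\<close>.\<close>
    then consider "p < j" | "j < p" "p < k" | "k < p" by linarith
    then show False
    proof cases
      case 1
      then have "\<pi> ! l \<noteq> Suc t" using is_perm_nth_inj[OF assms(1), of l p] pq jkl by auto
      then show False using av[of p j k l] 1 jkl c pq by (auto simp: evil4_def)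
    next
      case 2
      then have "\<pi> ! l \<noteq> Suc t" using is_perm_nth_inj[OF assms(1), of l p] pq jkl by auto
      then show False using av[of j p k l] 2 jkl c pq by (auto simp: evil4_def)
    next
      case 3
      then have "\<pi> ! k \<noteq> t" using is_perm_nth_inj[OF assms(1), of k q] pq jkl by auto
      then show False using av[of j k p q] 3 jkl c pq by (auto simp: evil4_def)
    qed
  qed
  then show ?thesis
    using assms(2) by (auto simp: evil_avoiding_iff avoid4_Cons avoid4_map_shift)
qed

section \<open>Sandwiched permutations\<close>

text \<open>This is the move made by \<open>gamma\<close>. An occurrence missing the moved value
  \<open>Suc a\<close> exists before the move as well. One using it is excluded by the shape: only
  \<open>m\<close> and the rising values up to \<open>a\<close> precede \<open>Suc a\<close>, and
  all later values are larger, those below \<open>m\<close> rising.\<close>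

lemma evil_move_into_prefix:
  assumes e: "evil_avoiding (m # [1..<Suc a] @ ys @ [Suc a..<m])" and big: "\<And>y. y \<in> set ys \<Longrightarrow> m < y"
    and am: "Suc a < m"
  shows "evil_avoiding (m # [1..<Suc a] @ Suc a # ys @ [Suc (Suc a)..<m])" (is "evil_avoiding ?\<sigma>")
proof -
  let ?\<tau> = "m # [1..<Suc a] @ ys @ [Suc a..<m]"
  let ?f = "filter (\<lambda>x. x \<noteq> Suc a)"
  have "[Suc a..<m] = Suc a # [Suc (Suc a)..<m]" using am by (rule upt_conv_Cons)
  then have f: "?f ?\<sigma> = ?f ?\<tau>" by simp
  \<comment> \<open>The leading \<open>m\<close> cancels the offset between 0-based indices and
    values starting at 1; in particular \<open>Suc a\<close> sits at index
    \<open>Suc a\<close>.\<close>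
  have low: "?\<sigma> ! i = (if i = 0 then m else i)" if "i \<le> Suc a" for i
    using that by (cases i) (auto simp: nth_append simp del: upt_Suc)
  have eq: "?\<sigma> ! i = (ys @ [Suc (Suc a)..<m]) ! (i - Suc (Suc a))" if "i > Suc a" for i
    using that by (cases i) (auto simp: nth_append nth_Cons' simp del: upt_Suc)
  have high: "?\<sigma> ! i > Suc a" if "i > Suc a" "i < length ?\<sigma>" for i
  proof -
    have "?\<sigma> ! i \<in> set (ys @ [Suc (Suc a)..<m])"
      unfolding eq[OF that(1)] by (rule nth_mem) (use that in \<open>auto simp del: upt_Suc\<close>)
    then show ?thesis using big am by fastforce
  qed
  have inc: "?\<sigma> ! i < ?\<sigma> ! j" if "i > Suc a" "i < j" "j < length ?\<sigma>" "?\<sigma> ! i < m" "?\<sigma> ! j < m" for i j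
  proof -
    have *: "length ys \<le> k - Suc (Suc a)" if "?\<sigma> ! k < m" "k > Suc a" for k
    proof (rule ccontr)
      assume "\<not> ?thesis"
      with that big[of "ys ! (k - Suc (Suc a))"] show False
        unfolding eq[OF that(2)] by (auto simp: nth_append)
    qed
    have v: "?\<sigma> ! k = k - length ys" if "?\<sigma> ! k < m" "k > Suc a" "k < length ?\<sigma>" for k
      using *[OF that(1,2)] that(2,3) unfolding eq[OF that(2)] by (simp add: nth_append del: upt_Suc)
    show ?thesis
      using *[of i] v[of i] v[of j] that by linarith
  qed
  define \<sigma> where "\<sigma> = ?\<sigma>"
  note low = low[folded \<sigma>_def] and high = high[folded \<sigma>_def] and inc = inc[folded \<sigma>_def]
    and f = f[folded \<sigma>_def]
  have "avoid4 evil4 \<sigma>"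
    unfolding avoid4_def
  proof (intro allI impI notI)
    fix i j k l
    assume ord: "i < j" "j < k" "k < l" "l < length \<sigma>" and ev: "evil4 (\<sigma> ! i) (\<sigma> ! j) (\<sigma> ! k) (\<sigma> ! l)"
    let ?q = "[\<sigma> ! i, \<sigma> ! j, \<sigma> ! k, \<sigma> ! l]"
    consider "Suc a \<notin> {i, j, k, l}" | "Suc a = i" | "Suc a = j" | "Suc a = k" | "Suc a = l" by blast
    then show False
    proof cases
      case 1
      have "\<sigma> ! x \<noteq> Suc a" if "x \<noteq> Suc a" "x < length \<sigma>" for x
        using low[of x] high[of x] that am by (cases "x \<le> Suc a") (auto split: if_splits)
      then have "?f ?q = ?q" using 1 ord by auto
      \<comment> \<open>An occurrence without \<open>Suc a\<close> survives the deletion of that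
        value, after which both lists coincide.\<close>
      moreover have "subseq ?q \<sigma>" unfolding subseq4_iff_nth using ord by blast
      ultimately have "subseq ?q (?f \<sigma>)" by (metis subseq_filter)
      then have "subseq ?q ?\<tau>" unfolding f by (rule subseq_order.trans) (rule subseq_filter_left)
      then show False using e ev unfolding evil_avoiding_iff avoid4_iff_subseq by blast
    next
      case 2
      then show False using low[of i] high[of k] high[of j] high[of l] ord ev by (auto simp: evil4_def)
    next
      case 3
      then have "\<sigma> ! i = (if i = 0 then m else i)" "\<sigma> ! j = Suc a" "\<sigma> ! k > Suc a" "\<sigma> ! l > Suc a"
        using low[of i] low[of j] high[of k] high[of l] ord by auto
      then show False using inc[of k l] ord ev 3 by (auto simp: evil4_def split: if_splits)
    next
      case 4
      then have "\<sigma> ! i = (if i = 0 then m else i)" "\<sigma> ! j = j" "\<sigma> ! k = Suc a" "\<sigma> ! l > Suc a"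
        using low[of i] low[of j] low[of k] high[of l] ord by auto
      then show False using ord ev 4 by (auto simp: evil4_def split: if_splits)
    next
      case 5
      then have "\<sigma> ! i = (if i = 0 then m else i)" "\<sigma> ! j = j" "\<sigma> ! k = k" "\<sigma> ! l = l"
        using low[of i] low[of j] low[of k] low[of l] ord by auto
      then show False using ord ev 5 am by (auto simp: evil4_def split: if_splits)
    qed
  qed
  then show ?thesis by (simp only: evil_avoiding_iff \<sigma>_def)
qed

text \<open>Prefix and suffix use up the values up to \<open>a + b\<close>, so the middle holds only
  larger ones; an empty middle would leave the identity.\<close>

lemma sandwiched_decomp:
  assumes "is_perm \<pi>" "\<not> identity_perm \<pi>" "sandwiched \<pi> a b"
  obtains ys where "\<pi> = [1..<Suc a] @ ys @ [Suc a..<Suc (a + b)]" "ys \<noteq> []" "\<And>y. y \<in> set ys \<Longrightarrow> a + b < y"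
proof -
  define ys where "ys = drop a (take (length \<pi> - b) \<pi>)"
  have ab: "a + b \<le> length \<pi>" using assms(3) by (simp add: sandwiched_def)
  have "\<pi> = take (length \<pi> - b) \<pi> @ drop (length \<pi> - b) \<pi>" by simp
  also have "take (length \<pi> - b) \<pi> = take a (take (length \<pi> - b) \<pi>) @ ys"
    unfolding ys_def by (rule append_take_drop_id[symmetric])
  also have "take a (take (length \<pi> - b) \<pi>) = take a \<pi>" using ab by (simp add: min_absorb1)
  finally have eq: "\<pi> = [1..<Suc a] @ ys @ [Suc a..<Suc (a + b)]"
    using assms(3) by (simp add: sandwiched_def del: upt_Suc)
  have "ys \<noteq> []"
  proof
    assume "ys = []"
    then have "\<pi> = [1..<Suc (a + b)]"
      using eq upt_add_eq_append[of 1 "Suc a" b] by (simp del: upt_Suc)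
    then show False using assms(2) by (metis Suc_eq_plus1 diff_Suc_1 identity_perm_def length_upt)
  qed
  moreover have "a + b < y" if y: "y \<in> set ys" for y
  proof (rule ccontr)
    assume "\<not> ?thesis"
    moreover have "1 \<le> y" using assms(1) y eq unfolding is_perm_def
      by (metis Un_iff atLeastAtMost_iff set_append)
    ultimately have "y \<in> set [1..<Suc a] \<or> y \<in> set [Suc a..<Suc (a + b)]" by (auto simp del: upt_Suc)
    moreover have "distinct ([1..<Suc a] @ ys @ [Suc a..<Suc (a + b)])"
      using assms(1) eq unfolding is_perm_def by metis
    ultimately show False using y by (auto simp del: upt_Suc)
  qed
  ultimately show ?thesis using that eq by blast
qed

text \<open>The values up to \<open>a + b\<close> appear in order, while \<open>a + b + 1\<close>
  lies in the middle block, before the final entry \<open>a + b\<close>.\<close>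

lemma sandwiched_smallest_recoil:
  assumes "is_perm \<pi>" "\<not> identity_perm \<pi>" "sandwiched \<pi> a b"
  shows "smallest_recoil \<pi> = a + b"
proof -
  obtain ys where eq: "\<pi> = [1..<Suc a] @ ys @ [Suc a..<Suc (a + b)]" and ys: "ys \<noteq> []"
    and big: "\<And>y. y \<in> set ys \<Longrightarrow> a + b < y" using sandwiched_decomp[OF assms] by metis
  have b: "b \<ge> 1" using assms(3) by (simp add: sandwiched_def)
  have len: "length \<pi> = a + b + length ys" by (subst eq) (simp del: upt_Suc)
  have ysl: "length ys > 0" using ys by simp
  have large: "\<pi> ! i > a + b" if "a \<le> i" "i < a + length ys" for i
  proof -
    have "i - a < length ys" using that by linarith
    then show ?thesis
      using that big[of "ys ! (i - a)"] by (subst eq) (simp add: nth_append del: upt_Suc)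
  qed
  have pre: "\<pi> ! i = Suc i" if "i < a" for i
    using that by (subst eq) (simp add: nth_append del: upt_Suc)
  have suf: "\<pi> ! i = Suc i - length ys" if "a + length ys \<le> i" "i < length \<pi>" for i
  proof -
    have "\<not> i - a < length ys" "length ys \<le> i" using that by linarith+
    then show ?thesis
      using that len by (subst eq) (simp add: nth_append Suc_diff_le del: upt_Suc)
  qed
  have "is_recoil \<pi> (a + b)"
  proof -
    obtain p where p: "p < length \<pi>" "\<pi> ! p = a + b + 1"
      using is_perm_obtain_index[OF assms(1), of "a + b + 1"] len ysl by auto
    have "p < a + length ys"
      using suf[of p] p len by (cases "p < a + length ys") auto
    moreover have "\<pi> ! (length \<pi> - 1) = a + b" using suf[of "length \<pi> - 1"] len b by simp
    ultimately show ?thesis unfolding is_recoil_def using p len ysl b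
      by (intro conjI exI[of _ p] exI[of _ "length \<pi> - 1"]) auto
  qed
  moreover have "\<not> is_recoil \<pi> i" if i: "i < a + b" for i
  proof
    assume "is_recoil \<pi> i"
    then obtain j k where jk: "j < k" "k < length \<pi>" "\<pi> ! j = i + 1" "\<pi> ! k = i"
      by (auto simp: is_recoil_def)
    have "j < a \<or> a + length ys \<le> j" "k < a \<or> a + length ys \<le> k"
      using large[of j] large[of k] jk i by linarith+
    then show False using pre[of j] pre[of k] suf[of j] suf[of k] jk by linarith
  qed
  ultimately show ?thesis unfolding smallest_recoil_def
    by (intro Least_equality) (auto simp: not_less[symmetric])
qed

text \<open>After the insertion at the front, the suffix starts at the 1-based position
  \<open>length \<pi> - b + 2\<close>, so \<open>gamma\<close> takes its first entry
  \<open>Suc a\<close> and puts it right behind the prefix, at position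
  \<open>a + 2\<close>.\<close>

lemma sandwiched_gamma_rho:
  assumes "is_perm \<pi>" "\<not> identity_perm \<pi>" "sandwiched \<pi> a b"
  obtains ys where
    "rho (a + b + 1) 1 \<pi> = Suc (a + b) # [1..<Suc a] @ ys @ [Suc a..<Suc (a + b)]"
    "gamma (length \<pi> - b + 2) (a + 2) (rho (a + b + 1) 1 \<pi>)
      = Suc (a + b) # [1..<Suc a] @ Suc a # ys @ [Suc (Suc a)..<Suc (a + b)]"
    "\<And>y. y \<in> set ys \<Longrightarrow> Suc (a + b) < y"
proof -
  obtain xs where eq: "\<pi> = [1..<Suc a] @ xs @ [Suc a..<Suc (a + b)]"
    and big: "\<And>y. y \<in> set xs \<Longrightarrow> a + b < y" using sandwiched_decomp[OF assms] by metis
  have b: "b \<ge> 1" using assms(3) by (simp add: sandwiched_def)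
  let ?ys = "map (shift (Suc (a + b))) xs"
  have id: "map (shift (Suc (a + b))) [c..<d] = [c..<d]" if "d \<le> Suc (a + b)" for c d
    by (rule map_idI) (use that in \<open>auto simp: shift_def\<close>)
  have r: "rho (a + b + 1) 1 \<pi> = Suc (a + b) # [1..<Suc a] @ ?ys @ [Suc a..<Suc (a + b)]"
    by (subst eq) (simp add: rho_first id del: upt_Suc)
  have len: "length \<pi> - b = a + length xs" by (subst eq) (simp del: upt_Suc)
  have c: "[Suc a..<Suc (a + b)] = Suc a # [Suc (Suc a)..<Suc (a + b)]"
    using b by (intro upt_conv_Cons) simp
  have g: "gamma (length \<pi> - b + 2) (a + 2) (rho (a + b + 1) 1 \<pi>)
      = Suc (a + b) # [1..<Suc a] @ Suc a # ?ys @ [Suc (Suc a)..<Suc (a + b)]"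
    unfolding r c len by (simp add: gamma_def nth_append numeral_2_eq_2 del: upt_Suc)
  have "Suc (a + b) < y" if "y \<in> set ?ys" for y
    using that big by (force simp: shift_def)
  with r g that show ?thesis by blast
qed

section \<open>Invariants of the evil-avoiding operators\<close>

text \<open>A final block 1, ..., \<open>t\<close> would have to begin at index 1, where the value 1
  is. It would leave only the maximum for the first entry, which is assumed to be smaller.\<close>

lemma not_s_domainI:
  assumes "is_perm \<sigma>" "length \<sigma> \<ge> 2" "\<sigma> ! 1 = 1" "\<sigma> ! 0 < length \<sigma>"
  shows "\<not> s_domain \<sigma> \<and> \<not> identity_perm \<sigma>"
proof -
  have hd1: "\<sigma> ! 0 \<noteq> 1" using is_perm_nth_inj[OF assms(1), of 0 1] assms(2,3) by (metis One_nat_def Suc_1 Suc_le_eq less_trans zero_less_one zero_neq_one)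
  have nid: "\<not> identity_perm \<sigma>"
  proof
    assume "identity_perm \<sigma>"
    then have "\<sigma> ! 0 = [1..<length \<sigma> + 1] ! 0" by (simp only: identity_perm_def)
    also have "\<dots> = 1" using assms(2) by (subst nth_upt) auto
    finally show False using hd1 by simp
  qed
  moreover have False if t: "t \<ge> 1" "t \<le> length \<sigma>" "drop (length \<sigma> - t) \<sigma> = [1..<t + 1]" for t
  proof -
    note v = suffix_upt_nth[OF assms(1) t(2,3)]
    have "\<sigma> ! (length \<sigma> - t) = 1" using v(1)[of "length \<sigma> - t"] t assms(2) by simp
    then have "length \<sigma> - t = 1" using is_perm_nth_inj[OF assms(1), of "length \<sigma> - t" 1] t assms by simp
    then have "\<sigma> ! 0 \<le> t" "0 < length \<sigma>" "\<not> length \<sigma> - t \<le> 0" using assms(2,4) by linarith+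
    then show False using v(2)[of 0] by blast
  qed
  ultimately show ?thesis by (auto simp: s_domain_def)
qed

text \<open>The move makes the second entry 1 also when \<open>a = 0\<close>; without it the result
  would in that case end in 1, ..., \<open>b\<close> and stay in the domain of s.\<close>

lemma psi_q_sandwiched:
  assumes "is_perm \<pi>" "evil_avoiding \<pi>" "\<not> identity_perm \<pi>" "sandwiched \<pi> a b"
  defines "\<sigma> \<equiv> gamma (length \<pi> - b + 2) (a + 2) (rho (smallest_recoil \<pi> + 1) 1 \<pi>)"
  shows "is_perm \<sigma> \<and> evil_avoiding \<sigma> \<and> \<not> s_domain \<sigma> \<and> \<not> identity_perm \<sigma>"
proof -
  have t: "smallest_recoil \<pi> = a + b" by (rule sandwiched_smallest_recoil[OF assms(1,3,4)])
  have b: "b \<ge> 1" using assms(4) by (simp add: sandwiched_def)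
  obtain ys where
    r: "rho (a + b + 1) 1 \<pi> = Suc (a + b) # [1..<Suc a] @ ys @ [Suc a..<Suc (a + b)]" (is "_ = ?\<tau>") and
    g: "gamma (length \<pi> - b + 2) (a + 2) (rho (a + b + 1) 1 \<pi>)
      = Suc (a + b) # [1..<Suc a] @ Suc a # ys @ [Suc (Suc a)..<Suc (a + b)]" (is "_ = ?\<sigma>") and
    big: "\<And>y. y \<in> set ys \<Longrightarrow> Suc (a + b) < y" by (rule sandwiched_gamma_rho[OF assms(1,3,4)]) blast
  have s: "\<sigma> = ?\<sigma>" unfolding \<sigma>_def t g ..
  have lt: "a + b < length \<pi>"
    using smallest_recoil(1)[OF assms(1,3)] t by (simp add: is_recoil_def)
  have tau: "?\<tau> = Suc (a + b) # map (shift (Suc (a + b))) \<pi>" unfolding r[symmetric] by (simp add: rho_first)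
  have p: "is_perm ?\<tau>" unfolding tau
    by (rule is_perm_insert) (use assms(1) lt in auto)
  have c: "[Suc a..<Suc (a + b)] = Suc a # [Suc (Suc a)..<Suc (a + b)]"
    using b by (intro upt_conv_Cons) simp
  have ps: "is_perm \<sigma>" using p unfolding s c is_perm_def by (auto simp del: upt_Suc)
  have "evil_avoiding ?\<tau>" unfolding tau
    using evil_insert_recoil[OF assms(1,2) smallest_recoil[OF assms(1,3)]] t by simp
  then have "evil_avoiding \<sigma>" unfolding s
    by (rule evil_move_into_prefix) (use big b in auto)
  moreover have "length \<sigma> = Suc (length \<pi>)"
    using arg_cong[OF tau, of length] b unfolding s by (simp del: upt_Suc)
  moreover have "\<sigma> ! 1 = 1" unfolding s by (simp add: nth_append nth_Cons' del: upt_Suc)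
  moreover have "\<sigma> ! 0 = Suc (a + b)" unfolding s by simp
  ultimately show ?thesis using not_s_domainI[OF ps] ps lt b by fastforce
qed

text \<open>A final block 1, ..., \<open>k\<close> of the result, if proper, avoids the new value
  \<open>Suc t\<close>, so \<open>k \<le> t\<close> and the relabelling fixes the block. Then
  \<open>\<pi>\<close> would already end in it and be (0, k)-sandwiched.\<close>

lemma psi_q_not_sandwiched:
  assumes "is_perm \<pi>" "evil_avoiding \<pi>" "\<not> identity_perm \<pi>" "\<nexists>a b. sandwiched \<pi> a b"
  defines "\<sigma> \<equiv> rho (smallest_recoil \<pi> + 1) 1 \<pi>"
  shows "is_perm \<sigma> \<and> evil_avoiding \<sigma> \<and> \<not> s_domain \<sigma> \<and> \<not> identity_perm \<sigma>"
proof -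
  define t where "t = smallest_recoil \<pi>"
  have s: "\<sigma> = Suc t # map (shift (Suc t)) \<pi>" by (simp add: \<sigma>_def t_def rho_first)
  have t: "1 \<le> t" "t < length \<pi>"
    using smallest_recoil(1)[OF assms(1,3)] by (simp_all add: is_recoil_def t_def)
  have "is_perm \<sigma>" unfolding s by (rule is_perm_insert) (use assms(1) t in auto)
  moreover have "evil_avoiding \<sigma>" unfolding s t_def
    by (rule evil_insert_recoil[OF assms(1,2) smallest_recoil[OF assms(1,3)]])
  moreover have nid: "\<sigma> \<noteq> [1..<k + 1]" if "k \<ge> 1" for k
  proof
    have "[1..<k + 1] = 1 # [Suc 1..<k + 1]" using that by (intro upt_conv_Cons) simp
    moreover assume "\<sigma> = [1..<k + 1]"
    ultimately show False using t by (simp add: s del: upt_Suc)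
  qed
  moreover have "length \<sigma> \<ge> 1" by (simp add: s)
  ultimately have *: "is_perm \<sigma>" "evil_avoiding \<sigma>" "\<not> identity_perm \<sigma>"
    by (auto simp: identity_perm_def simp del: upt_Suc)
  have False if k: "k \<ge> 1" "k \<le> length \<sigma>" "drop (length \<sigma> - k) \<sigma> = [1..<k + 1]" for k
  proof (cases "k = length \<sigma>")
    case True
    then show False using k nid[of k] by simp
  next
    case False
    then have kn: "k \<le> length \<pi>" using k(2) by (simp add: s)
    then have "length \<sigma> - k = Suc (length \<pi> - k)" by (simp add: s)
    then have eq: "map (shift (Suc t)) (drop (length \<pi> - k) \<pi>) = [1..<k + 1]"
      using k(3) by (simp add: s drop_map del: upt_Suc)
    have "Suc t \<notin> set [1..<k + 1]" unfolding eq[symmetric] by auto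
    then have kt: "k \<le> t" by auto
    have "shift (Suc t) x = x" if "x \<in> set (drop (length \<pi> - k) \<pi>)" for x
    proof -
      have "shift (Suc t) x \<in> set [1..<k + 1]" unfolding eq[symmetric] using that by simp
      then show ?thesis using kt by (auto simp: shift_def split: if_splits)
    qed
    then have "map (shift (Suc t)) (drop (length \<pi> - k) \<pi>) = drop (length \<pi> - k) \<pi>"
      by (rule map_idI)
    then have "sandwiched \<pi> 0 k" using eq k(1) kn by (simp add: sandwiched_def del: upt_Suc)
    then show False using assms(4) by blast
  qed
  then have "\<not> s_domain \<sigma>" using * by (auto simp: s_domain_def simp del: upt_Suc)
  with * show ?thesis by blast
qed

lemma psi_q:
  assumes "is_perm \<pi>" "evil_avoiding \<pi>" "\<not> identity_perm \<pi>"
  shows "is_perm (psi_q \<pi>) \<and> evil_avoiding (psi_q \<pi>) \<and> \<not> s_domain (psi_q \<pi>) \<and> \<not> identity_perm (psi_q \<pi>)"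
proof (cases "\<exists>a b. sandwiched \<pi> a b")
  case True
  \<comment> \<open>The choice of the pair is immaterial, as \<open>psi_q_sandwiched\<close> covers
    every sandwiching pair.\<close>
  obtain a b where ab: "(SOME ab. sandwiched \<pi> (fst ab) (snd ab)) = (a, b)" by fastforce
  from True have "\<exists>ab. sandwiched \<pi> (fst ab) (snd ab)" by auto
  from someI_ex[OF this] have "sandwiched \<pi> a b" unfolding ab by simp
  from psi_q_sandwiched[OF assms this] True show ?thesis by (simp add: psi_q_def ab Let_def)
next
  case False
  with psi_q_not_sandwiched[OF assms] show ?thesis by (simp add: psi_q_def Let_def)
qed

text \<open>A final block starting with 1 would begin at the new first entry and be the whole
  permutation, an identity; removing its 1 would leave \<open>\<pi>\<close> an identity.\<close>

lemma psi_p: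
  assumes "is_perm \<pi>" "evil_avoiding \<pi>" "\<not> identity_perm \<pi>"
  defines "\<sigma> \<equiv> rho 1 1 \<pi>"
  shows "is_perm \<sigma> \<and> evil_avoiding \<sigma> \<and> \<not> s_domain \<sigma> \<and> \<not> identity_perm \<sigma>"
proof -
  have s: "\<sigma> = 1 # map (shift 1) \<pi>" by (simp add: \<sigma>_def rho_first)
  have pos: "x > 0" if "x \<in> set \<pi>" for x using assms(1) that by (auto simp: is_perm_def)
  have p: "is_perm \<sigma>" unfolding s by (rule is_perm_insert) (use assms(1) in auto)
  have nid: "\<not> identity_perm \<sigma>"
  proof
    assume "identity_perm \<sigma>"
    then have "\<sigma> = [1..<Suc (Suc (length \<pi>))]" by (simp add: identity_perm_def s del: upt_Suc)
    also have "\<dots> = 1 # map Suc [1..<Suc (length \<pi>)]"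
      by (subst upt_conv_Cons) (simp_all add: map_Suc_upt del: upt_Suc)
    finally have "map (shift 1) \<pi> = map Suc [1..<Suc (length \<pi>)]" by (simp add: s del: upt_Suc)
    moreover have "map (shift 1) \<pi> = map Suc \<pi>" using pos by (auto simp: shift_def Suc_le_eq)
    ultimately have "map Suc \<pi> = map Suc [1..<Suc (length \<pi>)]" by simp
    then have "\<pi> = [1..<Suc (length \<pi>)]" using inj_map_eq_map[OF inj_Suc] by blast
    then show False using assms(3) by (simp add: identity_perm_def del: upt_Suc)
  qed
  have False if k: "k \<ge> 1" "k \<le> length \<sigma>" "drop (length \<sigma> - k) \<sigma> = [1..<k + 1]" for k
  proof -
    have "0 < length \<sigma>" "\<sigma> ! 0 \<le> k" using k(1) by (simp_all add: s)
    then have "length \<sigma> - k \<le> 0" using suffix_upt_nth(2)[OF p k(2,3), of 0] by blast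
    then have "identity_perm \<sigma>" using k by (simp add: identity_perm_def del: upt_Suc)
    with nid show False ..
  qed
  then have "\<not> s_domain \<sigma>" using nid by (auto simp: s_domain_def simp del: upt_Suc)
  with p nid evil_insert_1_first[OF assms(1,2)] show ?thesis by (simp add: s)
qed

lemma psi_r:
  assumes "is_perm \<pi>" "evil_avoiding \<pi>" "\<pi> \<noteq> []"
  defines "\<sigma> \<equiv> rho 1 (length \<pi> + 1) \<pi>"
  shows "is_perm \<sigma> \<and> evil_avoiding \<sigma> \<and> s_domain \<sigma> \<and> \<not> identity_perm \<sigma>"
proof -
  have s: "\<sigma> = map (shift 1) \<pi> @ [1]" by (simp add: \<sigma>_def rho_last)
  have "is_perm \<sigma>" unfolding s by (rule is_perm_insert) (use assms(1) in auto)
  moreover have "evil_avoiding \<sigma>" using evil_insert_1_last[OF assms(1,2)] by (simp add: s)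
  moreover have "s_domain \<sigma>" unfolding s_domain_def
    by (intro disjI2 exI[of _ 1]) (simp add: s)
  moreover have "\<not> identity_perm \<sigma>"
  proof
    assume "identity_perm \<sigma>"
    then have "last \<sigma> = last [1..<length \<sigma> + 1]" by (simp only: identity_perm_def)
    also have "\<dots> = length \<sigma>" by (simp add: s)
    finally show False using assms(3) by (simp add: s)
  qed
  ultimately show ?thesis by blast
qed

lemma is_perm_identity: "identity_perm \<pi> \<Longrightarrow> is_perm \<pi>"
  unfolding identity_perm_def is_perm_def
  by (metis Suc_eq_plus1 atLeastLessThanSuc_atLeastAtMost distinct_upt set_upt)

lemma psi_s_identity:
  assumes "identity_perm \<pi>" "\<pi> \<noteq> []"
  shows "identity_perm (rho (last \<pi> + 1) (length \<pi> + 1) \<pi>)"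
proof -
  define n where "n = length \<pi>"
  have eq: "\<pi> = [1..<Suc n]" and n: "n > 0" using assms by (simp_all add: identity_perm_def n_def del: upt_Suc)
  have "last \<pi> = n" using n by (simp add: eq)
  moreover have "map (shift (Suc n)) \<pi> = \<pi>" unfolding eq
    by (rule map_idI) (auto simp: shift_def)
  ultimately have "rho (last \<pi> + 1) (length \<pi> + 1) \<pi> = \<pi> @ [Suc n]"
    by (simp add: rho_last)
  also have "\<dots> = [1..<Suc (Suc n)]" using eq by simp
  finally show ?thesis by (simp add: identity_perm_def del: upt_Suc)
qed

text \<open>Off the identities the final block 1, ..., \<open>t\<close> is proper, so
  \<open>last \<pi> = t\<close>, and the appended entry extends the block by one.\<close>

lemma psi_s:
  assumes "is_perm \<pi>" "evil_avoiding \<pi>" "\<pi> \<noteq> []" "s_domain \<pi>"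
  defines "\<sigma> \<equiv> rho (last \<pi> + 1) (length \<pi> + 1) \<pi>"
  shows "is_perm \<sigma> \<and> evil_avoiding \<sigma> \<and> s_domain \<sigma> \<and> (identity_perm \<sigma> \<longleftrightarrow> identity_perm \<pi>)"
proof (cases "identity_perm \<pi>")
  case True
  with psi_s_identity assms(3) have "identity_perm \<sigma>" by (simp add: \<sigma>_def)
  with True show ?thesis using is_perm_identity identity_perm_evil by (auto simp: s_domain_def)
next
  case False
  then obtain t where t: "t \<ge> 1" "t \<le> length \<pi>" "drop (length \<pi> - t) \<pi> = [1..<t + 1]"
    using assms(4) by (auto simp: s_domain_def simp del: upt_Suc)
  have tn: "t < length \<pi>"
  proof (rule ccontr)
    assume "\<not> ?thesis"
    with t have "\<pi> = [1..<length \<pi> + 1]" by (simp del: upt_Suc)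
    with False show False by (simp add: identity_perm_def)
  qed
  have "last \<pi> = last (drop (length \<pi> - t) \<pi>)" using t(1) tn by (simp add: last_drop)
  then have "last \<pi> = t" unfolding t(3) using t(1) by simp
  then have s: "\<sigma> = map (shift (Suc t)) \<pi> @ [Suc t]" by (simp add: \<sigma>_def rho_last)
  have "is_perm \<sigma>" unfolding s by (rule is_perm_insert) (use assms(1) tn in auto)
  moreover have "evil_avoiding \<sigma>" unfolding s by (rule evil_insert_after_suffix[OF assms(1,2) t(2,3)])
  moreover have "s_domain \<sigma>" unfolding s_domain_def
  proof (intro disjI2 exI[of _ "Suc t"] conjI)
    have "map (shift (Suc t)) [1..<t + 1] = [1..<t + 1]"
      by (rule map_idI) (auto simp: shift_def)
    then show "drop (length \<sigma> - Suc t) \<sigma> = [1..<Suc t + 1]"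
      using t by (simp add: s drop_map)
  qed (use tn in \<open>simp_all add: s\<close>)
  moreover have "\<not> identity_perm \<sigma>"
  proof
    assume "identity_perm \<sigma>"
    then have "last \<sigma> = last [1..<length \<sigma> + 1]" by (simp only: identity_perm_def)
    also have "\<dots> = length \<sigma>" by (simp add: s)
    finally show False using tn by (simp add: s)
  qed
  ultimately show ?thesis using False by blast
qed

section \<open>Words of evil-avoiding operators\<close>

text \<open>An \<open>R\<close> somewhere to the right encodes that the permutation is not an
  identity; \<open>R\<close> or \<open>S\<close> directly to the right encodes
  \<open>s_domain\<close>.\<close>

fun evil_word :: "elet list \<Rightarrow> bool" where
  "evil_word [] \<longleftrightarrow> True"
| "evil_word (x # w) \<longleftrightarrow> evil_word w \<and>
     (if w = [] then x = S else (x \<in> {P, Q} \<longrightarrow> R \<in> set w) \<and> (x = S \<longrightarrow> hd w \<in> {R, S}))"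

lemma rho_neq_Nil: "rho i j \<pi> \<noteq> []"
  by (simp add: rho_def Let_def)

lemma psi_q_neq_Nil: "psi_q \<pi> \<noteq> []"
  by (simp add: psi_q_def Let_def rho_neq_Nil gamma_def split: prod.split)

text \<open>Two bits suffice to decide all domains, being an identity and lying in
  \<open>s_domain\<close>, and the letter together with the old bits determines the new
  ones.\<close>

lemma psiE_step:
  assumes "is_perm \<pi>" "evil_avoiding \<pi>" "\<pi> \<noteq> []"
  shows "(psiE x \<pi> \<noteq> None) \<longleftrightarrow> (x \<in> {P, Q} \<longrightarrow> \<not> identity_perm \<pi>) \<and> (x = S \<longrightarrow> s_domain \<pi>)"
    and "psiE x \<pi> = Some \<sigma> \<Longrightarrow> is_perm \<sigma> \<and> evil_avoiding \<sigma> \<and> \<sigma> \<noteq> [] \<and>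
      (identity_perm \<sigma> \<longleftrightarrow> identity_perm \<pi> \<and> x = S) \<and> (s_domain \<sigma> \<longleftrightarrow> x \<in> {R, S})"
proof -
  show "(psiE x \<pi> \<noteq> None) \<longleftrightarrow> (x \<in> {P, Q} \<longrightarrow> \<not> identity_perm \<pi>) \<and> (x = S \<longrightarrow> s_domain \<pi>)"
    using assms by (cases x) (auto simp: Suc_le_eq)
  assume "psiE x \<pi> = Some \<sigma>"
  then show "is_perm \<sigma> \<and> evil_avoiding \<sigma> \<and> \<sigma> \<noteq> [] \<and>
      (identity_perm \<sigma> \<longleftrightarrow> identity_perm \<pi> \<and> x = S) \<and> (s_domain \<sigma> \<longleftrightarrow> x \<in> {R, S})"
    using assms psi_p[OF assms(1,2)] psi_q[OF assms(1,2)] psi_r[OF assms] psi_s[OF assms]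
    by (cases x) (auto simp: rho_neq_Nil psi_q_neq_Nil split: if_splits)
qed

lemma apply_word_psiE:
  "(apply_word psiE w \<noteq> None \<longleftrightarrow> evil_word w) \<and>
   (\<forall>\<pi>. apply_word psiE w = Some \<pi> \<longrightarrow> w \<noteq> [] \<longrightarrow> is_perm \<pi> \<and> evil_avoiding \<pi> \<and> \<pi> \<noteq> [] \<and>
      (identity_perm \<pi> \<longleftrightarrow> R \<notin> set w) \<and> (s_domain \<pi> \<longleftrightarrow> hd w \<in> {R, S}))"
proof (induction w)
  case (Cons x w)
  show ?case
  proof (cases "w = []")
    case True
    have "identity_perm []" "identity_perm [Suc 0]" by (auto simp: identity_perm_def)
    then show ?thesis using True identity_perm_evil is_perm_identity
      by (cases x) (auto simp: s_domain_def)
  next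
    case False
    show ?thesis
    proof (cases "apply_word psiE w")
      case None
      with Cons False show ?thesis by auto
    next
      case (Some \<pi>)
      with Cons False have inv: "is_perm \<pi>" "evil_avoiding \<pi>" "\<pi> \<noteq> []"
        and ew: "evil_word w" and st: "identity_perm \<pi> \<longleftrightarrow> R \<notin> set w" "s_domain \<pi> \<longleftrightarrow> hd w \<in> {R, S}"
        by auto
      have ap: "apply_word psiE (x # w) = psiE x \<pi>" using Some by simp
      note dom = psiE_step(1)[OF inv, of x, unfolded st]
      have "psiE x \<pi> \<noteq> None \<longleftrightarrow> evil_word (x # w)"
        unfolding dom using ew False by simp
      moreover have "is_perm \<sigma> \<and> evil_avoiding \<sigma> \<and> \<sigma> \<noteq> [] \<and>
          (identity_perm \<sigma> \<longleftrightarrow> R \<notin> set (x # w)) \<and> (s_domain \<sigma> \<longleftrightarrow> hd (x # w) \<in> {R, S})"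
        if "psiE x \<pi> = Some \<sigma>" for \<sigma>
      proof -
        \<comment> \<open>\<open>P\<close> and \<open>Q\<close> leave the identities without adding
          an \<open>R\<close>; the bit stays correct because their domain already forces an earlier
          \<open>R\<close>.\<close>
        have "x \<in> {P, Q} \<longrightarrow> R \<in> set w" using dom that by blast
        then show ?thesis
          using psiE_step(2)[OF inv that, unfolded st] by (cases x) auto
      qed
      ultimately show ?thesis unfolding ap by blast
    qed
  qed
qed simp

lemma L_Evil_iff: "w \<in> L_Evil \<longleftrightarrow> w \<noteq> [] \<and> evil_word w"
  using apply_word_psiE[of w] by (simp add: L_Evil_def language_def)

section \<open>The bijection\<close>

lemma subst_inverse [simp]: "subst_ER (subst_RE x) = x" "subst_RE (subst_ER y) = y"
  by (cases x; simp) (cases y; simp)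

lemma subst_RE_eq_iff [simp]:
  "subst_RE x = P \<longleftrightarrow> x = Two" "subst_RE x = Q \<longleftrightarrow> x = U"
  "subst_RE x = R \<longleftrightarrow> x = D" "R = subst_RE x \<longleftrightarrow> x = D" "subst_RE x = S \<longleftrightarrow> x = One"
  by (cases x; simp)+

text \<open>Replaces the \<open>GREATEST\<close> index by a splitting of the word at its last
  \<open>R\<close>, which itself stays in place.\<close>

lemma rev_before_last_R_append:
  assumes "R \<notin> set y"
  shows "rev_before_last_R (v @ R # y) = rev v @ R # y"
proof -
  have "(GREATEST i. i < length (v @ R # y) \<and> (v @ R # y) ! i = R) = length v"
  proof (rule Greatest_equality)
    fix i assume i: "i < length (v @ R # y) \<and> (v @ R # y) ! i = R"
    show "i \<le> length v"
    proof (rule ccontr)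
      assume "\<not> ?thesis"
      with i have "y ! (i - Suc (length v)) = R" "i - Suc (length v) < length y"
        by (auto simp: nth_append nth_Cons')
      with assms show False by (metis nth_mem)
    qed
  qed simp
  then show ?thesis by (simp add: rev_before_last_R_def)
qed

lemma rev_before_last_R_cases:
  obtains "R \<notin> set w" "rev_before_last_R w = w"
  | v y where "w = v @ R # y" "R \<notin> set y" "rev_before_last_R w = rev v @ R # y"
  by (metis rev_before_last_R_append rev_before_last_R_def split_list_last)

lemma rev_before_last_R_involutive [simp]: "rev_before_last_R (rev_before_last_R w) = w"
  by (cases w rule: rev_before_last_R_cases) (simp_all add: rev_before_last_R_append)

lemma length_rev_before_last_R [simp]: "length (rev_before_last_R w) = length w"
  by (cases w rule: rev_before_last_R_cases) simp_all

text \<open>Holds for arbitrary words, since the reversal is an involution and the substitutions are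
  mutually inverse; only membership in the languages remains to be compared.\<close>

lemma bmap_inv_bmap: "bmap_inv (bmap w) = w"
  by (simp add: bmap_def bmap_inv_def comp_def)

lemma bmap_bmap_inv: "bmap (bmap_inv w) = w"
  by (simp add: bmap_def bmap_inv_def comp_def)

lemma length_bmap: "length (bmap w) = length w"
  by (simp add: bmap_def)

text \<open>The word starts from \<open>One\<close> on the right, and the first letter to differ
  from it would be a \<open>Two\<close> or \<open>U\<close> next to a \<open>One\<close>.\<close>

lemma rect_word_no_D: "D \<notin> set w \<Longrightarrow> rect_word w \<longleftrightarrow> set w \<subseteq> {One}"
proof (induction w)
  case (Cons x w)
  then show ?case by (cases w; cases x) auto
qed simp

lemma evil_word_no_R: "R \<notin> set w \<Longrightarrow> evil_word w \<longleftrightarrow> set w \<subseteq> {S}"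
proof (induction w)
  case (Cons x w)
  then show ?case by (cases w; cases x) auto
qed simp

text \<open>Any letter may stand directly to the left of \<open>D\<close>, so \<open>v\<close> is
  restricted only by its own adjacent pairs.\<close>

lemma rect_word_append:
  "rect_word (v @ D # y) \<longleftrightarrow> rect_word (D # y) \<and> successively (\<lambda>x z. \<not> (x \<in> {Two, U} \<and> z = One)) v"
  by (induction v) (auto simp: successively_Cons hd_append)

text \<open>The displayed \<open>R\<close> serves every \<open>P\<close> and \<open>Q\<close> in
  \<open>v\<close> and may be preceded by \<open>S\<close>, so again only adjacent pairs inside
  \<open>v\<close> matter.\<close>

lemma evil_word_append:
  "evil_word (v @ R # y) \<longleftrightarrow> evil_word (R # y) \<and> successively (\<lambda>x z. \<not> (x = S \<and> z \<in> {P, Q})) v"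
proof (induction v)
  case (Cons x v)
  show ?case
  proof (cases v)
    case (Cons z v')
    then show ?thesis using Cons.IH by (cases z) auto
  qed (use Cons.IH in auto)
qed simp

lemma evil_word_bmap: "evil_word (bmap w) \<longleftrightarrow> rect_word w"
proof (cases "D \<in> set w")
  case True
  then obtain v y where w: "w = v @ D # y" and y: "D \<notin> set y" by (metis split_list_last)
  have yR: "R \<notin> set (map subst_RE y)" using y by auto
  have b: "bmap w = rev (map subst_RE v) @ R # map subst_RE y"
    using rev_before_last_R_append[OF yR] by (simp add: bmap_def w)
  \<comment> \<open>Both sides say that \<open>y\<close> is nonempty and consists of
    \<open>One\<close> only.\<close>
  have "evil_word (R # map subst_RE y) \<longleftrightarrow> rect_word (D # y)"
    using rect_word_no_D[OF y] evil_word_no_R[OF yR] by auto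
  \<comment> \<open>Reversal exchanges the two arguments of the adjacency relation, turning the
    forbidden \<open>S\<close> before \<open>P\<close> or \<open>Q\<close> into \<open>Two\<close>
    or \<open>U\<close> before \<open>One\<close>.\<close>
  moreover have "successively (\<lambda>x z. \<not> (x = S \<and> z \<in> {P, Q})) (rev (map subst_RE v))
      \<longleftrightarrow> successively (\<lambda>x z. \<not> (x \<in> {Two, U} \<and> z = One)) v"
    by (simp add: successively_rev successively_map conj_commute)
  ultimately have "evil_word (bmap w) \<longleftrightarrow> rect_word (v @ D # y)"
    unfolding b rect_word_append evil_word_append by (simp only:)
  then show ?thesis by (simp only: w)
next
  case False
  then have R: "R \<notin> set (map subst_RE w)" by auto
  then have "bmap w = map subst_RE w" by (simp add: bmap_def rev_before_last_R_def)
  then show ?thesis using evil_word_no_R[OF R] rect_word_no_D[OF False] by auto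
qed

lemma bmap_in_L_Evil_iff: "bmap w \<in> L_Evil \<longleftrightarrow> w \<in> L_Rect"
  using length_bmap[of w] by (auto simp: L_Evil_iff L_Rect_iff evil_word_bmap)

theorem theorem3p7:
  shows "(\<forall>w \<in> L_Rect. bmap w \<in> L_Evil \<and> length (bmap w) = length w)
       \<and> bij_betw bmap L_Rect L_Evil
       \<and> (\<forall>w \<in> L_Evil. bmap_inv w \<in> L_Rect \<and> bmap (bmap_inv w) = w)
       \<and> (\<forall>w \<in> L_Rect. bmap_inv (bmap w) = w)"
proof -
  have inv: "bmap_inv w \<in> L_Rect" if "w \<in> L_Evil" for w
    using that bmap_in_L_Evil_iff[of "bmap_inv w"] by (simp add: bmap_bmap_inv)
  have "bij_betw bmap L_Rect L_Evil"
    by (rule bij_betw_byWitness[of _ bmap_inv])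
      (use inv in \<open>auto simp: bmap_inv_bmap bmap_bmap_inv bmap_in_L_Evil_iff\<close>)
  then show ?thesis
    using inv by (simp add: bmap_inv_bmap bmap_bmap_inv bmap_in_L_Evil_iff length_bmap)
qed

end
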